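(* Let $R$ be a non-zero ring with identity (not necessarily commutative), let $n\ge1$, and let $f(Z)=Z^n-a_1Z^{n-1}+\cdots+(-1)^{n-1}a_{n-1}Z+(-1)^na_n\in R[Z]$. Let $L_f$ be the two-sided ideal of $R$ generated by all commutators $xa_i-a_ix$ with $x\in R$, $1\le i\le n$, let $T_f=R/L_f$, and let $\pi:R[Z]\to T_f[Z]$ be the ring epimorphism induced by the canonical projection $R\to T_f$ (with $Z\mapsto Z$). Then the universal splitting ring for $f$ over $R$ is isomorphic, as ring and $T_f$-module, to the universal splitting ring for $\pi(f)$ over $T_f$.
   Context: In polynomial rings the variables commute with each other and with the coefficients. For a ring $A$ with identity and a monic polynomial $h(Z)=Z^n-c_1Z^{n-1}+\cdots+(-1)^nc_n\in A[Z]$, the universal splitting ring for $h$ over $A$ is $A_h=A[X_1,\dots,X_n]/I_h$, where $I_h$ is the two-sided ideal generated by $\sigma_1-c_1,\dots,\sigma_n-c_n$ and $\sigma_1,\dots,\sigma_n$ are the elementary symmetric polynomials in $X_1,\dots,X_n$ (if $A$ is the zero ring, $A_h$ is the zero ring). Since $L_f\subseteq I_f$, the $R$-module structure of $R_f$ induces a $T_f$-module structure on $R_f$. *)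

theory Defs
  imports "HOL-Algebra.Indexed_Polynomials" "HOL-Algebra.UnivPoly"
begin

text \<open>
  The ring \<open>A[X\<^sub>1,\<dots>,X\<^sub>n]\<close> over a not necessarily commutative ring \<open>A\<close>, as a left \<open>A\<close>-module.
  The carrier is that of \<^theory>\<open>HOL-Algebra.Indexed_Polynomials\<close>: a polynomial maps a monomial,
  i.e. a multiset of indices, to its coefficient. That theory only provides multiplication by a
  single variable; here the full product is the convolution, which makes the variables commute
  with each other and with the coefficients.
\<close>

definition mpoly_ring :: "('a, 'm) ring_scheme \<Rightarrow> nat \<Rightarrow> ('a, nat multiset \<Rightarrow> 'a) module"
  where "mpoly_ring A n =
    \<lparr>carrier = ring.indexed_pset A {1..n} (carrier A),
     monoid.mult = (\<lambda>p q m. \<Oplus>\<^bsub>A\<^esub>k\<in>{k. k \<subseteq># m}. p k \<otimes>\<^bsub>A\<^esub> q (m - k)),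
     one = ring.indexed_const A \<one>\<^bsub>A\<^esub>,
     zero = ring.indexed_const A \<zero>\<^bsub>A\<^esub>,
     add = ring.indexed_padd A,
     smult = (\<lambda>a p m. a \<otimes>\<^bsub>A\<^esub> p m)\<rparr>"

text \<open>The inner function is the squarefree monomial \<open>\<Prod>j\<in>S. X\<^sub>j\<close>.\<close>

definition elem_sym :: "('a, 'm) ring_scheme \<Rightarrow> nat \<Rightarrow> nat \<Rightarrow> (nat multiset \<Rightarrow> 'a)"
  where "elem_sym A n i =
    (\<Oplus>\<^bsub>mpoly_ring A n\<^esub>S\<in>{S. S \<subseteq> {1..n} \<and> card S = i}.
       (\<lambda>m. if m = mset_set S then \<one>\<^bsub>A\<^esub> else \<zero>\<^bsub>A\<^esub>))"

text \<open>The polynomial \<open>Z\<^sup>n - c\<^sub>1 Z\<^sup>n\<^sup>-\<^sup>1 + \<dots> + (-1)\<^sup>n c\<^sub>n\<close>.\<close>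

definition monic_poly :: "('a, 'm) ring_scheme \<Rightarrow> nat \<Rightarrow> (nat \<Rightarrow> 'a) \<Rightarrow> (nat \<Rightarrow> 'a)"
  where "monic_poly A n c =
    monom (UP A) \<one>\<^bsub>A\<^esub> n \<oplus>\<^bsub>UP A\<^esub>
    (\<Oplus>\<^bsub>UP A\<^esub>i\<in>{1..n}. monom (UP A) ((\<ominus>\<^bsub>A\<^esub> \<one>\<^bsub>A\<^esub>) [^]\<^bsub>A\<^esub> i \<otimes>\<^bsub>A\<^esub> c i) (n - i))"

text \<open>The \<open>c\<^sub>i\<close> of a monic polynomial \<open>h\<close> of degree \<open>n\<close> written in the above form.\<close>

definition signed_coeff :: "('a, 'm) ring_scheme \<Rightarrow> nat \<Rightarrow> (nat \<Rightarrow> 'a) \<Rightarrow> nat \<Rightarrow> 'a"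
  where "signed_coeff A n h i =
    (\<ominus>\<^bsub>A\<^esub> \<one>\<^bsub>A\<^esub>) [^]\<^bsub>A\<^esub> i \<otimes>\<^bsub>A\<^esub> coeff (UP A) h (n - i)"

definition splitting_ideal :: "('a, 'm) ring_scheme \<Rightarrow> nat \<Rightarrow> (nat \<Rightarrow> 'a) \<Rightarrow> (nat multiset \<Rightarrow> 'a) set"
  where "splitting_ideal A n h =
    Idl\<^bsub>mpoly_ring A n\<^esub>
      ((\<lambda>i. elem_sym A n i \<ominus>\<^bsub>mpoly_ring A n\<^esub> ring.indexed_const A (signed_coeff A n h i)) ` {1..n})"

text \<open>
  The degree \<open>n\<close> is an explicit argument because over the zero ring it is not determined by \<open>h\<close>
  (the result is then the zero ring for every \<open>n\<close>). The scalar multiplication is the left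
  \<open>A\<close>-module structure \<open>a \<cdot> (I + p) = I + a p\<close>, in the style of \<^const>\<open>rcoset_mult\<close>.
\<close>

definition univ_splitting_ring ::
    "('a, 'm) ring_scheme \<Rightarrow> nat \<Rightarrow> (nat \<Rightarrow> 'a) \<Rightarrow> ('a, (nat multiset \<Rightarrow> 'a) set) module"
  where "univ_splitting_ring A n h =
    (let P = mpoly_ring A n; I = splitting_ideal A n h; Q = P Quot I
     in \<lparr>carrier = carrier Q, monoid.mult = monoid.mult Q, one = one Q, zero = zero Q, add = add Q,
         smult = (\<lambda>a C. \<Union>p\<in>C. I +>\<^bsub>P\<^esub> (a \<odot>\<^bsub>P\<^esub> p))\<rparr>)"

definition comm_ideal :: "('a, 'm) ring_scheme \<Rightarrow> nat \<Rightarrow> (nat \<Rightarrow> 'a) \<Rightarrow> 'a set"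
  where "comm_ideal R n a =
    Idl\<^bsub>R\<^esub> {x \<otimes>\<^bsub>R\<^esub> a i \<ominus>\<^bsub>R\<^esub> a i \<otimes>\<^bsub>R\<^esub> x | x i. x \<in> carrier R \<and> i \<in> {1..n}}"

text \<open>The map \<open>R[Z] \<rightarrow> (R/L)[Z]\<close> induced by the canonical projection.\<close>

definition quot_poly :: "('a, 'm) ring_scheme \<Rightarrow> 'a set \<Rightarrow> (nat \<Rightarrow> 'a) \<Rightarrow> (nat \<Rightarrow> 'a set)"
  where "quot_poly R L p = (\<lambda>k. L +>\<^bsub>R\<^esub> coeff (UP R) p k)"

text \<open>
  For an \<open>R\<close>-module \<open>M\<close> on which an ideal \<open>L\<close> acts as zero, the induced \<open>R/L\<close>-module: a coset
  acts as any of its elements.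
\<close>

definition induced_module :: "('a, 'b) module \<Rightarrow> ('a set, 'b) module"
  where "induced_module M =
    \<lparr>carrier = carrier M, monoid.mult = monoid.mult M, one = one M, zero = zero M, add = add M,
     smult = (\<lambda>t x. the_elem ((\<lambda>r. r \<odot>\<^bsub>M\<^esub> x) ` t))\<rparr>"

lemma finite_submultisets: "finite {k. k \<subseteq># m}"
proof (induction m)
  case (add x m)
  have "k \<in> {k. k \<subseteq># m} \<union> add_mset x ` {k. k \<subseteq># m}" if "k \<subseteq># add_mset x m" for k
  proof (cases "x \<in># k")
    case True
    then obtain k' where "k = add_mset x k'" by (metis insert_DiffM)
    with that show ?thesis by auto
  next
    case False
    then have "k \<subseteq># m" using that
      by (metis diff_single_trivial subset_eq_diff_conv add_mset_add_single)
    then show ?thesis by simp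
  qed
  then have "{k. k \<subseteq># add_mset x m} \<subseteq> {k. k \<subseteq># m} \<union> add_mset x ` {k. k \<subseteq># m}" by blast
  then show ?case using add by (meson finite_UnI finite_imageI finite_subset)
qed simp

context ring
begin

lemma monomial_in_indexed_pset:
  assumes "c \<in> carrier R" and "set_mset M \<subseteq> I"
  shows "(\<lambda>m. if m = M then c else \<zero>) \<in> indexed_pset I (carrier R)"
  using assms(2)
proof (induction M)
  case empty
  then show ?case using indexed_pset.indexed_const[OF assms(1), of I] by (simp add: indexed_const_def)
next
  case (add i M)
  have "indexed_pmult (\<lambda>m. if m = M then c else \<zero>) i = (\<lambda>m. if m = add_mset i M then c else \<zero>)"
    by (auto simp: indexed_pmult_def fun_eq_iff dest!: multi_member_split)
  with indexed_pset.indexed_pmult[of _ I "carrier R" i] add show ?case by fastforce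
qed

lemma indexed_pset_iff:
  "P \<in> indexed_pset I (carrier R) \<longleftrightarrow>
     (\<forall>m. P m \<in> carrier R) \<and> finite {m. P m \<noteq> \<zero>} \<and> (\<forall>m. P m \<noteq> \<zero> \<longrightarrow> set_mset m \<subseteq> I)"
  (is "?l \<longleftrightarrow> ?r")
proof
  assume ?l
  then show ?r
  proof induction
    case (indexed_const k)
    have "{m. ring.indexed_const R k m \<noteq> \<zero>} \<subseteq> {{#}}" by (auto simp: indexed_const_def)
    with indexed_const show ?case by (auto simp: indexed_const_def intro: finite_subset)
  next
    case (indexed_padd P Q)
    have "{m. indexed_padd P Q m \<noteq> \<zero>} \<subseteq> {m. P m \<noteq> \<zero>} \<union> {m. Q m \<noteq> \<zero>}"
      using indexed_padd by (auto simp: indexed_padd_def)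
    moreover have "finite ({m. P m \<noteq> \<zero>} \<union> {m. Q m \<noteq> \<zero>})" using indexed_padd by simp
    ultimately have "finite {m. indexed_padd P Q m \<noteq> \<zero>}" by (rule finite_subset)
    moreover have "set_mset m \<subseteq> I" if "P m \<oplus> Q m \<noteq> \<zero>" for m
    proof -
      have "P m \<noteq> \<zero> \<or> Q m \<noteq> \<zero>" using that by auto
      then show ?thesis using indexed_padd by blast
    qed
    ultimately show ?case using indexed_padd by (simp add: indexed_padd_def)
  next
    case (indexed_pmult P i)
    have "{m. indexed_pmult P i m \<noteq> \<zero>} \<subseteq> add_mset i ` {m. P m \<noteq> \<zero>}"
      by (auto simp: indexed_pmult_def image_iff dest!: multi_member_split split: if_splits)
    then have "finite {m. indexed_pmult P i m \<noteq> \<zero>}"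
      using indexed_pmult by (meson finite_imageI finite_subset)
    moreover have "set_mset m \<subseteq> I" if "indexed_pmult P i m \<noteq> \<zero>" for m
    proof -
      have "i \<in># m" "P (m - {#i#}) \<noteq> \<zero>" using that by (auto simp: indexed_pmult_def split: if_splits)
      moreover from this have "set_mset m = insert i (set_mset (m - {#i#}))" by (metis insert_DiffM set_mset_add_mset_insert)
      ultimately show ?thesis using indexed_pmult by auto
    qed
    ultimately show ?case using indexed_pmult by (auto simp: indexed_pmult_def)
  qed
next
  assume r: ?r
  have "F \<subseteq> {m. P m \<noteq> \<zero>} \<Longrightarrow> (\<lambda>m. if m \<in> F then P m else \<zero>) \<in> indexed_pset I (carrier R)"
    if "finite F" for F using that
  proof induction
    case empty
    then show ?case using indexed_pset.indexed_const[OF zero_closed, of I] by (simp add: indexed_const_def)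
  next
    case (insert M F)
    have "(\<lambda>m. if m \<in> insert M F then P m else \<zero>) =
        indexed_padd (\<lambda>m. if m = M then P M else \<zero>) (\<lambda>m. if m \<in> F then P m else \<zero>)"
      using insert r by (auto simp: fun_eq_iff indexed_padd_def)
    with insert r show ?case by (auto intro!: indexed_pset.indexed_padd monomial_in_indexed_pset)
  qed
  from this[of "{m. P m \<noteq> \<zero>}"] have "(\<lambda>m. if P m \<noteq> \<zero> then P m else \<zero>) \<in> indexed_pset I (carrier R)"
    using r by simp
  also have "(\<lambda>m. if P m \<noteq> \<zero> then P m else \<zero>) = P" by auto
  finally show ?l .
qed

lemma finsum_Sigma:
  assumes "finite A" "\<And>x. x \<in> A \<Longrightarrow> finite (B x)"
    and "\<And>x y. x \<in> A \<Longrightarrow> y \<in> B x \<Longrightarrow> g x y \<in> carrier R"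
  shows "(\<Oplus>x\<in>A. \<Oplus>y\<in>B x. g x y) = (\<Oplus>z\<in>Sigma A B. g (fst z) (snd z))"
proof -
  have "(\<Oplus>z\<in>(\<Union>x\<in>A. Pair x ` B x). g (fst z) (snd z)) =
      (\<Oplus>x\<in>A. \<Oplus>z\<in>Pair x ` B x. g (fst z) (snd z))"
    using assms by (intro add.finprod_UN_disjoint) (auto simp: pairwise_def disjnt_def)
  also have "\<dots> = (\<Oplus>x\<in>A. \<Oplus>y\<in>B x. g x y)"
  proof (rule add.finprod_cong')
    show "finsum R (\<lambda>z. g (fst z) (snd z)) (Pair x ` B x) = (\<Oplus>y\<in>B x. g x y)" if "x \<in> A" for x
      using that assms by (subst finsum_reindex) (auto simp: inj_on_def)
  qed (use assms in \<open>auto intro!: finsum_closed\<close>)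
  also have "(\<Union>x\<in>A. Pair x ` B x) = Sigma A B" by auto
  finally show ?thesis by simp
qed

abbreviation pconv :: "(nat multiset \<Rightarrow> 'a) \<Rightarrow> (nat multiset \<Rightarrow> 'a) \<Rightarrow> nat multiset \<Rightarrow> 'a"
  where "pconv p q m \<equiv> \<Oplus>k\<in>{k. k \<subseteq># m}. p k \<otimes> q (m - k)"

lemma pconv_closed:
  assumes "\<And>m. p m \<in> carrier R" "\<And>m. q m \<in> carrier R"
  shows "pconv p q m \<in> carrier R"
  using assms by (auto intro!: finsum_closed)

lemma pconv_nonzeroE:
  assumes "\<And>m. p m \<in> carrier R" "\<And>m. q m \<in> carrier R" "pconv p q m \<noteq> \<zero>"
  obtains k l where "m = k + l" "p k \<noteq> \<zero>" "q l \<noteq> \<zero>"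
proof -
  have "\<exists>k. k \<subseteq># m \<and> p k \<otimes> q (m - k) \<noteq> \<zero>"
  proof (rule ccontr)
    assume "\<not> ?thesis"
    then have "pconv p q m = (\<Oplus>k\<in>{k. k \<subseteq># m}. \<zero>)" by (intro finsum_cong') auto
    with assms(3) show False by simp
  qed
  then obtain k where k: "k \<subseteq># m" "p k \<otimes> q (m - k) \<noteq> \<zero>" by blast
  show thesis
  proof (rule that[of k "m - k"])
    show "p k \<noteq> \<zero>" using k assms(1,2) by auto
    show "q (m - k) \<noteq> \<zero>" using k assms(1,2) by auto
  qed (use k in simp)
qed

lemma pconv_assoc:
  assumes "\<And>m. p m \<in> carrier R" "\<And>m. q m \<in> carrier R" "\<And>m. r m \<in> carrier R"
  shows "pconv (pconv p q) r m = pconv p (pconv q r) m"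
proof -
  note fin = finite_submultisets
  let ?S = "SIGMA k:{k. k \<subseteq># m}. {j. j \<subseteq># k}"
  let ?T = "SIGMA j:{j. j \<subseteq># m}. {l. l \<subseteq># m - j}"
  let ?F = "\<lambda>z. p (fst z) \<otimes> (q (snd z) \<otimes> r (m - fst z - snd z))"
  let ?h = "\<lambda>z. (snd z, fst z - snd z)"
  have inj: "inj_on ?h ?S"
    by (auto simp: inj_on_def) (metis subset_mset.diff_add)
  have im: "?h ` ?S = ?T"
  proof (intro equalityI subsetI)
    fix z assume "z \<in> ?h ` ?S"
    then obtain k j where "z = (j, k - j)" "k \<subseteq># m" "j \<subseteq># k" by auto
    then show "z \<in> ?T" 
      by (auto simp: subset_mset.le_diff_conv2 intro: subset_mset.order_trans)
  next
    fix z assume "z \<in> ?T"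
    then obtain j l where z: "z = (j, l)" "j \<subseteq># m" "l \<subseteq># m - j" by auto
    then have "(j + l, j) \<in> ?S" by (simp add: subset_mset.le_diff_conv2 add.commute)
    then show "z \<in> ?h ` ?S" using z by (force simp: image_iff)
  qed
  have "pconv (pconv p q) r m = (\<Oplus>k\<in>{k. k \<subseteq># m}. \<Oplus>j\<in>{j. j \<subseteq># k}. p j \<otimes> q (k - j) \<otimes> r (m - k))"
    using assms by (intro finsum_cong') (auto intro!: finsum_closed finsum_ldistr fin)
  also have "\<dots> = (\<Oplus>z\<in>?S. p (snd z) \<otimes> q (fst z - snd z) \<otimes> r (m - fst z))"
    using assms by (intro finsum_Sigma) (auto simp: fin)
  also have "\<dots> = (\<Oplus>z\<in>?S. ?F (?h z))"
    using assms by (intro finsum_cong')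
      (auto simp: m_assoc diff_diff_add_mset)
  also have "\<dots> = (\<Oplus>z\<in>?T. ?F z)"
    unfolding im[symmetric] using assms by (subst finsum_reindex[OF _ inj]) auto
  also have "\<dots> = (\<Oplus>j\<in>{j. j \<subseteq># m}. \<Oplus>l\<in>{l. l \<subseteq># m - j}. p j \<otimes> (q l \<otimes> r (m - j - l)))"
    using assms by (intro finsum_Sigma[symmetric]) (auto simp: fin)
  also have "\<dots> = pconv p (pconv q r) m"
    using assms by (intro finsum_cong') (auto intro!: finsum_closed finsum_rdistr[symmetric] fin)
  finally show ?thesis .
qed

lemma pconv_const_left:
  assumes "c \<in> carrier R" "\<And>m. p m \<in> carrier R"
  shows "pconv (indexed_const c) p m = c \<otimes> p m"
proof -
  have "pconv (indexed_const c) p m = (\<Oplus>k\<in>{k. k \<subseteq># m}. if {#} = k then c \<otimes> p (m - k) else \<zero>)"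
    using assms by (intro finsum_cong') (auto simp: indexed_const_def)
  also have "\<dots> = c \<otimes> p (m - {#})"
    using assms by (intro add.finprod_singleton[of "{#}" _ "\<lambda>k. c \<otimes> p (m - k)"]) (auto simp: finite_submultisets)
  finally show ?thesis by simp
qed

lemma pconv_const_right:
  assumes "c \<in> carrier R" "\<And>m. p m \<in> carrier R"
  shows "pconv p (indexed_const c) m = p m \<otimes> c"
proof -
  have *: "m - k = {#} \<longleftrightarrow> k = m" if "k \<subseteq># m" for k
    using that by (metis Diff_eq_empty_iff_mset subset_mset.order_antisym subset_mset.order_refl)
  have "pconv p (indexed_const c) m = (\<Oplus>k\<in>{k. k \<subseteq># m}. if m = k then p k \<otimes> c else \<zero>)"
    using assms * by (intro finsum_cong') (auto simp: indexed_const_def)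
  also have "\<dots> = p m \<otimes> c"
    using assms by (intro add.finprod_singleton[of m _ "\<lambda>k. p k \<otimes> c"]) (auto simp: finite_submultisets)
  finally show ?thesis .
qed

lemma mpoly_ring_is_ring: "ring (mpoly_ring R n)"
proof -
  let ?C = "indexed_pset {1..n} (carrier R)"
  have C: "p m \<in> carrier R" if "p \<in> ?C" for p m using that by (simp add: indexed_pset_iff)
  have mult: "pconv p q \<in> ?C" if "p \<in> ?C" "q \<in> ?C" for p q
  proof -
    have c: "\<And>m. p m \<in> carrier R" "\<And>m. q m \<in> carrier R" using C that by auto
    have "{m. pconv p q m \<noteq> \<zero>} \<subseteq> (\<lambda>(k, l). k + l) ` ({m. p m \<noteq> \<zero>} \<times> {m. q m \<noteq> \<zero>})"
      by (auto elim!: pconv_nonzeroE[OF c])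
    moreover have "finite ({m. p m \<noteq> \<zero>} \<times> {m. q m \<noteq> \<zero>})"
      using that by (auto simp: indexed_pset_iff)
    ultimately have "finite {m. pconv p q m \<noteq> \<zero>}" by (meson finite_imageI finite_subset)
    moreover have "set_mset m \<subseteq> {1..n}" if "pconv p q m \<noteq> \<zero>" for m
      using that \<open>p \<in> ?C\<close> \<open>q \<in> ?C\<close>
      by (elim pconv_nonzeroE[OF c]) (auto simp: indexed_pset_iff)
    ultimately show ?thesis using pconv_closed[of p q, OF c] by (simp add: indexed_pset_iff)
  qed
  have uminus: "(\<lambda>m. \<ominus> p m) \<in> ?C" if "p \<in> ?C" for p
    using that by (simp add: indexed_pset_iff)
  show ?thesis
  proof (rule ringI)
    show "abelian_group (mpoly_ring R n)"
    proof (rule abelian_groupI, goal_cases)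
      case (6 x)
      then show ?case using uminus[of x] C[of x]
        by (intro bexI[of _ "\<lambda>m. \<ominus> x m"])
          (auto simp: mpoly_ring_def indexed_padd_def indexed_const_def fun_eq_iff l_neg)
    qed (auto simp: mpoly_ring_def indexed_padd_def fun_eq_iff C a_ac indexed_zero_def
           intro: indexed_pset.indexed_padd[unfolded indexed_padd_def]
             indexed_pset.indexed_const[OF zero_closed, unfolded indexed_zero_def])
    show "Group.monoid (mpoly_ring R n)"
      by (rule monoidI)
        (auto simp: mpoly_ring_def C mult pconv_assoc pconv_const_left pconv_const_right
           simp del: One_nat_def intro: indexed_pset.indexed_const)
    show "(x \<oplus>\<^bsub>mpoly_ring R n\<^esub> y) \<otimes>\<^bsub>mpoly_ring R n\<^esub> z =
        x \<otimes>\<^bsub>mpoly_ring R n\<^esub> z \<oplus>\<^bsub>mpoly_ring R n\<^esub> y \<otimes>\<^bsub>mpoly_ring R n\<^esub> z"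
      if "x \<in> carrier (mpoly_ring R n)" "y \<in> carrier (mpoly_ring R n)" "z \<in> carrier (mpoly_ring R n)" for x y z
      using that by (auto simp: mpoly_ring_def fun_eq_iff indexed_padd_def C l_distr intro!: finsum_addf)
    show "z \<otimes>\<^bsub>mpoly_ring R n\<^esub> (x \<oplus>\<^bsub>mpoly_ring R n\<^esub> y) =
        z \<otimes>\<^bsub>mpoly_ring R n\<^esub> x \<oplus>\<^bsub>mpoly_ring R n\<^esub> z \<otimes>\<^bsub>mpoly_ring R n\<^esub> y"
      if "x \<in> carrier (mpoly_ring R n)" "y \<in> carrier (mpoly_ring R n)" "z \<in> carrier (mpoly_ring R n)" for x y z
      using that by (auto simp: mpoly_ring_def fun_eq_iff indexed_padd_def C r_distr intro!: finsum_addf)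
  qed
qed


lemma mpoly_ring_simps:
  "carrier (mpoly_ring R n) = indexed_pset {1..n} (carrier R)"
  "p \<otimes>\<^bsub>mpoly_ring R n\<^esub> q = pconv p q"
  "\<one>\<^bsub>mpoly_ring R n\<^esub> = indexed_const \<one>"
  "\<zero>\<^bsub>mpoly_ring R n\<^esub> = indexed_const \<zero>"
  "p \<oplus>\<^bsub>mpoly_ring R n\<^esub> q = indexed_padd p q"
  "c \<odot>\<^bsub>mpoly_ring R n\<^esub> p = (\<lambda>m. c \<otimes> p m)"
  by (simp_all add: mpoly_ring_def fun_eq_iff)

lemma indexed_const_ring_hom: "indexed_const \<in> ring_hom R (mpoly_ring R n)"
  by (rule ring_hom_memI)
    (simp_all add: mpoly_ring_simps fun_eq_iff pconv_const_left indexed_padd_const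
      indexed_pset.indexed_const indexed_const_in_carrier[OF order_refl],
      simp add: indexed_const_def)

lemma elem_sym_closed: "elem_sym R n i \<in> carrier (mpoly_ring R n)"
proof -
  interpret P: ring "mpoly_ring R n" by (rule mpoly_ring_is_ring)
  show ?thesis unfolding elem_sym_def
    by (rule P.finsum_closed)
      (auto simp: mpoly_ring_simps finite_subset[OF _ finite_atLeastAtMost]
        simp del: One_nat_def atLeastAtMost_iff intro!: monomial_in_indexed_pset)
qed

lemma elem_sym_central:
  assumes "c \<in> carrier R"
  shows "indexed_const c \<otimes>\<^bsub>mpoly_ring R n\<^esub> elem_sym R n i =
    elem_sym R n i \<otimes>\<^bsub>mpoly_ring R n\<^esub> indexed_const c"
proof -
  interpret P: ring "mpoly_ring R n" by (rule mpoly_ring_is_ring)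
  let ?S = "{S. S \<subseteq> {1..n} \<and> card S = i}"
  have fin: "finite ?S" by simp
  have mon: "(\<lambda>S m. if m = mset_set S then \<one> else \<zero>) \<in> ?S \<rightarrow> carrier (mpoly_ring R n)"
    by (auto simp: mpoly_ring_simps finite_subset[OF _ finite_atLeastAtMost]
        simp del: One_nat_def atLeastAtMost_iff intro!: monomial_in_indexed_pset)
  have c: "indexed_const c \<in> carrier (mpoly_ring R n)"
    using ring_hom_closed[OF indexed_const_ring_hom assms] .
  show ?thesis unfolding elem_sym_def P.finsum_rdistr[OF fin c mon] P.finsum_ldistr[OF fin c mon]
  proof (rule P.finsum_cong'[OF refl])
    let ?X = "\<lambda>S m. if m = mset_set S then \<one> else \<zero>"
    have "?X S m \<in> carrier R" for S :: "nat set" and m by simp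
    then show "indexed_const c \<otimes>\<^bsub>mpoly_ring R n\<^esub> ?X S = ?X S \<otimes>\<^bsub>mpoly_ring R n\<^esub> indexed_const c" for S
      using assms pconv_const_left[of c "?X S"] pconv_const_right[of c "?X S"]
      by (auto simp add: mpoly_ring_simps(2))
  qed (use mon c in auto)
qed

lemma coeff_monic_poly:
  assumes "\<And>i. i \<in> {1..n} \<Longrightarrow> c i \<in> carrier R"
  shows "monic_poly R n c \<in> carrier (UP R)"
    and "up_ring.coeff (UP R) (monic_poly R n c) k =
      (if k = n then \<one> else if k < n then (\<ominus> \<one>) [^] (n - k) \<otimes> c (n - k) else \<zero>)"
proof -
  interpret UP: UP_ring R "UP R" by unfold_locales
  let ?d = "\<lambda>i. (\<ominus> \<one>) [^] i \<otimes> c i"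
  have d: "?d i \<in> carrier R" if "i \<in> {1..n}" for i using assms[OF that] by simp
  then have m: "(\<lambda>i. up_ring.monom (UP R) (?d i) (n - i)) \<in> {1..n} \<rightarrow> carrier (UP R)" by auto
  show "monic_poly R n c \<in> carrier (UP R)"
    unfolding monic_poly_def using UP.P.finsum_closed[OF m] by simp
  have "up_ring.coeff (UP R) (monic_poly R n c) k =
      up_ring.coeff (UP R) (up_ring.monom (UP R) \<one> n) k \<oplus>
      (\<Oplus>i\<in>{1..n}. up_ring.coeff (UP R) (up_ring.monom (UP R) (?d i) (n - i)) k)"
    unfolding monic_poly_def using UP.P.finsum_closed[OF m]
    by (simp add: UP.coeff_finsum[OF _ m] del: One_nat_def atLeastAtMost_iff UP.coeff_monom)
  also have "\<dots> = (if n = k then \<one> else \<zero>) \<oplus> (\<Oplus>i\<in>{1..n}. if n - i = k then ?d i else \<zero>)"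
  proof -
    have "(\<Oplus>i\<in>{1..n}. up_ring.coeff (UP R) (up_ring.monom (UP R) (?d i) (n - i)) k) =
        (\<Oplus>i\<in>{1..n}. if n - i = k then ?d i else \<zero>)"
    proof (rule finsum_cong'[OF refl])
      show "(\<lambda>i. if n - i = k then ?d i else \<zero>) \<in> {1..n} \<rightarrow> carrier R" using d by auto
      show "up_ring.coeff (UP R) (up_ring.monom (UP R) (?d i) (n - i)) k =
          (if n - i = k then ?d i else \<zero>)" if "i \<in> {1..n}" for i
        using d[OF that] by (rule UP.coeff_monom)
    qed
    then show ?thesis by simp
  qed
  also have "(\<Oplus>i\<in>{1..n}. if n - i = k then ?d i else \<zero>) = (if k < n then ?d (n - k) else \<zero>)"
  proof (cases "k < n")
    case True
    have "(\<Oplus>i\<in>{1..n}. if n - i = k then ?d i else \<zero>) = (\<Oplus>i\<in>{1..n}. if n - k = i then ?d i else \<zero>)"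
      using True d by (intro finsum_cong') auto
    also have "\<dots> = ?d (n - k)" using True d by (intro add.finprod_singleton) auto
    finally show ?thesis using True by simp
  next
    case False
    then have "(\<Oplus>i\<in>{1..n}. if n - i = k then ?d i else \<zero>) = (\<Oplus>i\<in>{1..n}. \<zero>)"
      by (intro finsum_cong') auto
    then show ?thesis using False by simp
  qed
  finally show "up_ring.coeff (UP R) (monic_poly R n c) k =
      (if k = n then \<one> else if k < n then (\<ominus> \<one>) [^] (n - k) \<otimes> c (n - k) else \<zero>)"
    using d[of "n - k"] by (cases "k < n") auto
qed

lemma signed_coeff_monic_poly:
  assumes "\<And>i. i \<in> {1..n} \<Longrightarrow> c i \<in> carrier R" and "i \<in> {1..n}"
  shows "signed_coeff R n (monic_poly R n c) i = c i"
proof -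
  have "(\<ominus> \<one>) [^] i \<otimes> (\<ominus> \<one>) [^] i = ((\<ominus> \<one>) \<otimes> (\<ominus> \<one>)) [^] i"
    by (rule pow_mult_distrib[symmetric]) auto
  also have "\<dots> = \<one>" by (simp add: l_minus)
  finally have sq: "(\<ominus> \<one>) [^] i \<otimes> (\<ominus> \<one>) [^] i = \<one>" .
  have "signed_coeff R n (monic_poly R n c) i = (\<ominus> \<one>) [^] i \<otimes> ((\<ominus> \<one>) [^] i \<otimes> c i)"
    using assms(2) coeff_monic_poly(2)[OF assms(1), where k = "n - i"] by (auto simp: signed_coeff_def)
  also have "\<dots> = c i" using assms sq by (simp add: m_assoc[symmetric])
  finally show ?thesis .
qed

lemma splitting_ideal_ideal:
  assumes "\<And>i. i \<in> {1..n} \<Longrightarrow> signed_coeff R n h i \<in> carrier R"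
  shows "ideal (splitting_ideal R n h) (mpoly_ring R n)"
proof -
  interpret P: ring "mpoly_ring R n" by (rule mpoly_ring_is_ring)
  show ?thesis unfolding splitting_ideal_def
    by (rule P.genideal_ideal)
      (auto intro!: P.minus_closed elem_sym_closed ring_hom_closed[OF indexed_const_ring_hom] assms)
qed

lemma comm_ideal_ideal:
  assumes "\<And>i. i \<in> {1..n} \<Longrightarrow> a i \<in> carrier R"
  shows "ideal (comm_ideal R n a) R"
  unfolding comm_ideal_def using assms by (intro genideal_ideal) auto

lemma comm_ideal_subset_splitting_ideal:
  assumes a: "\<And>i. i \<in> {1..n} \<Longrightarrow> a i \<in> carrier R" and "r \<in> comm_ideal R n a"
  shows "indexed_const r \<in> splitting_ideal R n (monic_poly R n a)"
proof -
  let ?P = "mpoly_ring R n" and ?I = "splitting_ideal R n (monic_poly R n a)"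
  interpret P: ring ?P by (rule mpoly_ring_is_ring)
  interpret I: ideal ?I ?P 
    by (rule splitting_ideal_ideal) (simp add: signed_coeff_monic_poly a del: One_nat_def atLeastAtMost_iff)
  interpret H: ring_hom_ring R ?P indexed_const
    by (rule ring_hom_ringI2[OF ring_axioms P.ring_axioms indexed_const_ring_hom])
  let ?J = "{r \<in> carrier R. indexed_const r \<in> ?I}"
  have "ideal ?J R"
    by (rule idealI[OF ring_axioms add.subgroupI])
      (auto simp: I.I_l_closed I.I_r_closed I.a_closed I.a_inv_closed I.zero_closed intro!: exI[of _ \<zero>])
  moreover have "x \<otimes> a i \<ominus> a i \<otimes> x \<in> ?J" if x: "x \<in> carrier R" and i: "i \<in> {1..n}" for x i
  proof -
    define s where "s = elem_sym R n i"
    have s: "s \<in> carrier ?P" unfolding s_def by (rule elem_sym_closed)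
    define g where "g = s \<ominus>\<^bsub>?P\<^esub> indexed_const (a i)"
    have "g \<in> ?I" unfolding g_def s_def splitting_ideal_def
    proof (rule P.genideal_self[THEN subsetD])
      show "(\<lambda>i. elem_sym R n i \<ominus>\<^bsub>?P\<^esub> indexed_const (signed_coeff R n (monic_poly R n a) i)) ` {1..n} \<subseteq> carrier ?P"
        by (auto simp: signed_coeff_monic_poly a elem_sym_closed simp del: One_nat_def atLeastAtMost_iff)
      show "elem_sym R n i \<ominus>\<^bsub>?P\<^esub> indexed_const (a i) \<in>
          (\<lambda>i. elem_sym R n i \<ominus>\<^bsub>?P\<^esub> indexed_const (signed_coeff R n (monic_poly R n a) i)) ` {1..n}"
        using i signed_coeff_monic_poly[OF a i] by (intro image_eqI[of _ _ i]) auto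
    qed
    then have "g \<otimes>\<^bsub>?P\<^esub> indexed_const x \<ominus>\<^bsub>?P\<^esub> indexed_const x \<otimes>\<^bsub>?P\<^esub> g \<in> ?I"
      using x by (simp add: I.I_l_closed I.I_r_closed I.a_closed I.a_inv_closed P.minus_eq)
    also have "g \<otimes>\<^bsub>?P\<^esub> indexed_const x \<ominus>\<^bsub>?P\<^esub> indexed_const x \<otimes>\<^bsub>?P\<^esub> g =
        indexed_const x \<otimes>\<^bsub>?P\<^esub> indexed_const (a i) \<ominus>\<^bsub>?P\<^esub> indexed_const (a i) \<otimes>\<^bsub>?P\<^esub> indexed_const x"
    proof -
      have "s \<otimes>\<^bsub>?P\<^esub> indexed_const x = indexed_const x \<otimes>\<^bsub>?P\<^esub> s"
        unfolding s_def using elem_sym_central[OF x] by simp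
      with s x a[OF i] show ?thesis unfolding g_def
        by (simp add: P.minus_eq P.l_distr P.r_distr P.l_minus P.r_minus P.minus_add P.minus_minus P.a_ac
            P.r_neg1 P.r_neg2)
    qed
    also have "\<dots> = indexed_const (x \<otimes> a i \<ominus> a i \<otimes> x)"
      using x a[OF i] by (simp add: minus_eq P.minus_eq)
    finally show ?thesis using x a[OF i] by simp
  qed
  ultimately have "comm_ideal R n a \<subseteq> ?J"
    unfolding comm_ideal_def by (intro genideal_minimal) auto
  with assms(2) show ?thesis by blast
qed

lemma univ_splitting_ring_smult:
  assumes "\<And>i. i \<in> {1..n} \<Longrightarrow> signed_coeff R n h i \<in> carrier R"
    and r: "r \<in> carrier R" and p: "p \<in> carrier (mpoly_ring R n)"
  shows "r \<odot>\<^bsub>univ_splitting_ring R n h\<^esub> (splitting_ideal R n h +>\<^bsub>mpoly_ring R n\<^esub> p) =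
    splitting_ideal R n h +>\<^bsub>mpoly_ring R n\<^esub> (indexed_const r \<otimes>\<^bsub>mpoly_ring R n\<^esub> p)"
proof -
  let ?P = "mpoly_ring R n" and ?I = "splitting_ideal R n h"
  interpret P: ring ?P by (rule mpoly_ring_is_ring)
  interpret I: ideal ?I ?P by (rule splitting_ideal_ideal) (fact assms)
  have c: "indexed_const r \<in> carrier ?P" using ring_hom_closed[OF indexed_const_ring_hom r] .
  have sm: "r \<odot>\<^bsub>?P\<^esub> q = indexed_const r \<otimes>\<^bsub>?P\<^esub> q" if "q \<in> carrier ?P" for q
    using that r by (auto simp: mpoly_ring_simps pconv_const_left fun_eq_iff indexed_pset_iff)
  have "?I +>\<^bsub>?P\<^esub> (r \<odot>\<^bsub>?P\<^esub> q) = ?I +>\<^bsub>?P\<^esub> (indexed_const r \<otimes>\<^bsub>?P\<^esub> p)" if "q \<in> ?I +>\<^bsub>?P\<^esub> p" for q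
  proof -
    obtain u where u: "u \<in> ?I" "q = u \<oplus>\<^bsub>?P\<^esub> p" using \<open>q \<in> _\<close> by (auto simp: a_r_coset_def r_coset_def)
    then have "u \<in> carrier ?P" by (simp add: I.a_Hcarr)
    with u p c have "r \<odot>\<^bsub>?P\<^esub> q = indexed_const r \<otimes>\<^bsub>?P\<^esub> u \<oplus>\<^bsub>?P\<^esub> indexed_const r \<otimes>\<^bsub>?P\<^esub> p"
      by (simp add: sm P.r_distr)
    then have "r \<odot>\<^bsub>?P\<^esub> q \<in> ?I +>\<^bsub>?P\<^esub> (indexed_const r \<otimes>\<^bsub>?P\<^esub> p)"
      using u c by (auto simp: a_r_coset_def r_coset_def intro!: I.I_l_closed)
    then show ?thesis using I.a_repr_independence' c p by blast
  qed
  moreover have "p \<in> ?I +>\<^bsub>?P\<^esub> p" using p by (rule I.a_rcos_self)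
  ultimately show ?thesis by (auto simp: univ_splitting_ring_def Let_def)
qed

text \<open>\<open>L \<subseteq> I\<close> makes \<^const>\<open>induced_module\<close> well-defined: \<^const>\<open>the_elem\<close> is applied to a singleton.\<close>

lemma induced_module_smult:
  assumes a: "\<And>i. i \<in> {1..n} \<Longrightarrow> a i \<in> carrier R" and r: "r \<in> carrier R"
    and x: "x \<in> carrier (univ_splitting_ring R n (monic_poly R n a))"
  shows "(comm_ideal R n a +> r) \<odot>\<^bsub>induced_module (univ_splitting_ring R n (monic_poly R n a))\<^esub> x =
    r \<odot>\<^bsub>univ_splitting_ring R n (monic_poly R n a)\<^esub> x"
proof -
  let ?P = "mpoly_ring R n" and ?I = "splitting_ideal R n (monic_poly R n a)"
  let ?M = "univ_splitting_ring R n (monic_poly R n a)" and ?L = "comm_ideal R n a"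
  interpret P: ring ?P by (rule mpoly_ring_is_ring)
  have sc: "signed_coeff R n (monic_poly R n a) i \<in> carrier R" if "i \<in> {1..n}" for i
    using that by (simp add: signed_coeff_monic_poly a del: One_nat_def atLeastAtMost_iff)
  interpret I: ideal ?I ?P by (rule splitting_ideal_ideal) (fact sc)
  interpret L: ideal ?L R by (rule comm_ideal_ideal) (fact a)
  interpret H: ring_hom_ring R ?P indexed_const
    by (rule ring_hom_ringI2[OF ring_axioms P.ring_axioms indexed_const_ring_hom])
  obtain p where p: "p \<in> carrier ?P" "x = ?I +>\<^bsub>?P\<^esub> p"
    using x by (auto simp: univ_splitting_ring_def Let_def FactRing_simps)
  have "s \<odot>\<^bsub>?M\<^esub> x = r \<odot>\<^bsub>?M\<^esub> x" if "s \<in> ?L +> r" for s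
  proof -
    obtain l where l: "l \<in> ?L" "s = l \<oplus> r" 
      using \<open>s \<in> _\<close> by (auto simp: a_r_coset_def r_coset_def)
    have lc: "l \<in> carrier R" using l by (simp add: L.a_Hcarr)
    have "indexed_const s \<otimes>\<^bsub>?P\<^esub> p = indexed_const l \<otimes>\<^bsub>?P\<^esub> p \<oplus>\<^bsub>?P\<^esub> indexed_const r \<otimes>\<^bsub>?P\<^esub> p"
      using l lc r p by (simp add: P.l_distr)
    moreover have "indexed_const l \<otimes>\<^bsub>?P\<^esub> p \<in> ?I"
      using comm_ideal_subset_splitting_ideal[OF a l(1)] p by (simp add: I.I_r_closed)
    ultimately have "indexed_const s \<otimes>\<^bsub>?P\<^esub> p \<in> ?I +>\<^bsub>?P\<^esub> (indexed_const r \<otimes>\<^bsub>?P\<^esub> p)"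
      by (auto simp: a_r_coset_def r_coset_def)
    then have "?I +>\<^bsub>?P\<^esub> (indexed_const s \<otimes>\<^bsub>?P\<^esub> p) = ?I +>\<^bsub>?P\<^esub> (indexed_const r \<otimes>\<^bsub>?P\<^esub> p)"
      using I.a_repr_independence' p r by (metis H.hom_closed P.m_closed)
    moreover have "s \<in> carrier R" using l lc r by simp
    ultimately show ?thesis unfolding p(2)
      using p(1) r by (simp only: univ_splitting_ring_smult[OF sc])
  qed
  moreover have "r \<in> ?L +> r" using r by (rule L.a_rcos_self)
  ultimately have "(\<lambda>s. s \<odot>\<^bsub>?M\<^esub> x) ` (?L +> r) = {r \<odot>\<^bsub>?M\<^esub> x}" by blast
  then show ?thesis by (simp add: induced_module_def)
qed

end

end

theory Submission
  imports Defs
begin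

text \<open>
  The kernel of the coefficientwise projection \<open>R[X\<^sub>1,\<dots>,X\<^sub>n] \<rightarrow> T\<^sub>f[X\<^sub>1,\<dots>,X\<^sub>n]\<close> consists of the
  polynomials with coefficients in \<open>L\<^sub>f\<close>. Since \<open>L\<^sub>f \<subseteq> I\<^sub>f\<close>, it lies in \<open>I\<^sub>f\<close>. The projection is onto
  and carries the generators of \<open>I\<^sub>f\<close> to those of the splitting ideal of \<open>\<pi>(f)\<close>, so the latter
  is the image of \<open>I\<^sub>f\<close> and the quotients agree by the isomorphism theorem.
\<close>

lemma carrier_FactRing: "carrier (A Quot I) = (+>\<^bsub>A\<^esub>) I ` carrier A"
  by (auto simp: FactRing_simps)

lemma coeff_UP: "p \<in> up A \<Longrightarrow> up_ring.coeff (UP A) p = p"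
  by (simp add: UP_def)

section \<open>Ideals and quotient rings under a surjective homomorphism\<close>

context ring_hom_ring
begin

text \<open>Surjectivity gives absorption: a factor from \<open>S\<close> is the image of a factor
  from \<open>R\<close>, so the product is taken in \<open>R\<close> and mapped over.\<close>

lemma image_ideal:
  assumes surj: "h ` carrier R = carrier S" and "ideal I R"
  shows "ideal (h ` I) S"
proof -
  interpret I: ideal I R by fact
  show ?thesis
  proof (rule idealI[OF S.ring_axioms])
    show "subgroup (h ` I) (add_monoid S)"
      by (rule img_is_add_subgroup[OF I.a_subgroup])
  next
    fix b y assume "b \<in> h ` I" and "y \<in> carrier S"
    then obtain i r where i: "i \<in> I" "b = h i" and r: "r \<in> carrier R" "y = h r"
      using surj by blast
    have "y \<otimes>\<^bsub>S\<^esub> b = h (r \<otimes>\<^bsub>R\<^esub> i)" and "b \<otimes>\<^bsub>S\<^esub> y = h (i \<otimes>\<^bsub>R\<^esub> r)"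
      using i r I.a_Hcarr by simp_all
    then show "y \<otimes>\<^bsub>S\<^esub> b \<in> h ` I" and "b \<otimes>\<^bsub>S\<^esub> y \<in> h ` I"
      using i r I.I_l_closed I.I_r_closed by blast+
  qed
qed

text \<open>Both inclusions follow from minimality of generated ideals: the preimage of the right
  side is an ideal containing \<open>G\<close>, and by \<open>image_ideal\<close> the left side is
  an ideal containing the image of \<open>G\<close>.\<close>

lemma image_genideal:
  assumes surj: "h ` carrier R = carrier S" and G: "G \<subseteq> carrier R"
  shows "h ` (Idl\<^bsub>R\<^esub> G) = Idl\<^bsub>S\<^esub> (h ` G)"
proof
  have hG: "h ` G \<subseteq> carrier S" using G by auto
  have "Idl\<^bsub>R\<^esub> G \<subseteq> {r \<in> carrier R. h r \<in> Idl\<^bsub>S\<^esub> (h ` G)}"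
    using G S.genideal_self[OF hG]
    by (intro R.genideal_minimal[OF ideal_vimage[OF S.genideal_ideal[OF hG]]]) auto
  then show "h ` (Idl\<^bsub>R\<^esub> G) \<subseteq> Idl\<^bsub>S\<^esub> (h ` G)" by auto
  show "Idl\<^bsub>S\<^esub> (h ` G) \<subseteq> h ` (Idl\<^bsub>R\<^esub> G)"
    using R.genideal_self[OF G]
    by (intro S.genideal_minimal[OF image_ideal[OF surj R.genideal_ideal[OF G]]]) auto
qed

text \<open>Two elements with the same image differ by an element of the kernel, and
  \<open>I\<close> absorbs that difference.\<close>

lemma mem_image_ideal_iff:
  assumes "ideal I R" and ker: "a_kernel R S h \<subseteq> I" and x: "x \<in> carrier R"
  shows "h x \<in> h ` I \<longleftrightarrow> x \<in> I"
proof
  interpret I: ideal I R by fact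
  assume "h x \<in> h ` I"
  then obtain i where i: "i \<in> I" "h x = h i" by auto
  then have "x \<in> a_kernel R S h +>\<^bsub>R\<^esub> i" using x I.a_Hcarr by (intro homeq_imp_rcos)
  then obtain k where "k \<in> a_kernel R S h" "x = k \<oplus>\<^bsub>R\<^esub> i"
    by (auto simp: a_r_coset_def r_coset_def)
  then show "x \<in> I" using ker i by (auto intro: I.a_closed)
qed simp

text \<open>This is the isomorphism theorem for \<open>?g\<close>, whose kernel is exactly
  \<open>I\<close> by \<open>mem_image_ideal_iff\<close>. The value on cosets is recorded so that
  compatibility with scalars can later be checked on representatives.\<close>

lemma ideal_quotient_iso:
  assumes surj: "h ` carrier R = carrier S" and I: "ideal I R" and ker: "a_kernel R S h \<subseteq> I"
  shows "\<exists>\<phi>\<in>ring_iso (R Quot I) (S Quot (h ` I)).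
           \<forall>x\<in>carrier R. \<phi> (I +>\<^bsub>R\<^esub> x) = h ` I +>\<^bsub>S\<^esub> h x"
proof -
  let ?J = "h ` I"
  let ?g = "\<lambda>x. ?J +>\<^bsub>S\<^esub> h x"
  interpret I: ideal I R by fact
  interpret J: ideal ?J S by (rule image_ideal[OF surj I])
  interpret Q: ring "S Quot ?J" by (rule J.quotient_is_ring)
  have "(+>\<^bsub>S\<^esub>) ?J \<circ> h \<in> ring_hom R (S Quot ?J)"
    by (rule ring_hom_trans[OF homh J.rcos_ring_hom])
  then interpret g: ring_hom_ring R "S Quot ?J" ?g
    by (intro ring_hom_ringI2 R.ring_axioms Q.ring_axioms) (simp add: comp_def)
  have "a_kernel R (S Quot ?J) ?g = {x \<in> carrier R. h x \<in> ?J}"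
  proof -
    have "?J +>\<^bsub>S\<^esub> y = ?J \<longleftrightarrow> y \<in> ?J" if "y \<in> carrier S" for y
      using that J.a_rcos_self J.a_rcos_const by blast
    then show ?thesis unfolding a_kernel_def' FactRing_def ring.simps using hom_closed by blast
  qed
  also have "\<dots> = I" using mem_image_ideal_iff[OF I ker] I.a_Hcarr by blast
  finally have k: "a_kernel R (S Quot ?J) ?g = I" .
  have "?g ` carrier R = carrier (S Quot ?J)"
    unfolding carrier_FactRing surj[symmetric] image_image ..
  \<comment> \<open>\<open>?g\<close> is constant on each coset of its kernel \<open>I\<close>, so
    \<open>the_elem\<close> is applied to a singleton.\<close>
  then have "(\<lambda>C. the_elem (?g ` C)) \<in> ring_iso (R Quot I) (S Quot ?J)"
    by (rule g.FactRing_iso_set[unfolded k])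
  moreover have "the_elem (?g ` (I +>\<^bsub>R\<^esub> x)) = ?g x" if "x \<in> carrier R" for x
    using that by (rule g.the_elem_simp[unfolded k])
  ultimately show ?thesis by (intro bexI ballI)
qed

section \<open>Extending a homomorphism coefficientwise to polynomials\<close>

lemma comp_ring_hom_mpoly_ring: "(\<circ>) h \<in> ring_hom (mpoly_ring R n) (mpoly_ring S n)"
proof (rule ring_hom_memI)
  fix p assume "p \<in> carrier (mpoly_ring R n)"
  then have p: "\<forall>m. p m \<in> carrier R" "finite {m. p m \<noteq> \<zero>\<^bsub>R\<^esub>}" "\<forall>m. p m \<noteq> \<zero>\<^bsub>R\<^esub> \<longrightarrow> set_mset m \<subseteq> {1..n}"
    by (simp_all add: R.mpoly_ring_simps R.indexed_pset_iff)
  have nz: "p m \<noteq> \<zero>\<^bsub>R\<^esub>" if "h (p m) \<noteq> \<zero>\<^bsub>S\<^esub>" for m using that by auto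
  then have "{m. h (p m) \<noteq> \<zero>\<^bsub>S\<^esub>} \<subseteq> {m. p m \<noteq> \<zero>\<^bsub>R\<^esub>}" by auto
  then have "finite {m. h (p m) \<noteq> \<zero>\<^bsub>S\<^esub>}" using p(2) by (rule finite_subset)
  then show "h \<circ> p \<in> carrier (mpoly_ring S n)"
    using p nz by (auto simp: S.mpoly_ring_simps S.indexed_pset_iff)
next
  fix p q assume "p \<in> carrier (mpoly_ring R n)" "q \<in> carrier (mpoly_ring R n)"
  then have pq: "\<And>m. p m \<in> carrier R" "\<And>m. q m \<in> carrier R"
    by (simp_all add: R.mpoly_ring_simps R.indexed_pset_iff)
  show "h \<circ> (p \<oplus>\<^bsub>mpoly_ring R n\<^esub> q) = (h \<circ> p) \<oplus>\<^bsub>mpoly_ring S n\<^esub> (h \<circ> q)"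
    using pq by (simp add: R.mpoly_ring_simps S.mpoly_ring_simps R.indexed_padd_def S.indexed_padd_def fun_eq_iff)
  \<comment> \<open>Each coefficient of a product is a finite sum of products, which
    \<open>h\<close> respects term by term.\<close>
  have "h (R.pconv p q m) = S.pconv (h \<circ> p) (h \<circ> q) m" for m
    using pq by (subst hom_finsum) (auto intro!: S.finsum_cong')
  then show "h \<circ> (p \<otimes>\<^bsub>mpoly_ring R n\<^esub> q) = (h \<circ> p) \<otimes>\<^bsub>mpoly_ring S n\<^esub> (h \<circ> q)"
    by (simp add: R.mpoly_ring_simps S.mpoly_ring_simps fun_eq_iff)
next
  show "h \<circ> \<one>\<^bsub>mpoly_ring R n\<^esub> = \<one>\<^bsub>mpoly_ring S n\<^esub>"
    by (simp add: R.mpoly_ring_simps S.mpoly_ring_simps R.indexed_const_def S.indexed_const_def fun_eq_iff)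
qed

lemma comp_ring_hom_ring_mpoly_ring:
  "ring_hom_ring (mpoly_ring R n) (mpoly_ring S n) ((\<circ>) h)"
  by (intro ring_hom_ringI2 R.mpoly_ring_is_ring S.mpoly_ring_is_ring comp_ring_hom_mpoly_ring)

lemma comp_indexed_const: "h \<circ> R.indexed_const c = S.indexed_const (h c)"
  by (simp add: R.indexed_const_def S.indexed_const_def fun_eq_iff)

lemma comp_mpoly_ring_surj:
  assumes surj: "h ` carrier R = carrier S"
  shows "(\<circ>) h ` carrier (mpoly_ring R n) = carrier (mpoly_ring S n)"
proof
  show "(\<circ>) h ` carrier (mpoly_ring R n) \<subseteq> carrier (mpoly_ring S n)"
    using ring_hom_closed[OF comp_ring_hom_mpoly_ring] by auto
  show "carrier (mpoly_ring S n) \<subseteq> (\<circ>) h ` carrier (mpoly_ring R n)"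
  proof
    fix q assume "q \<in> carrier (mpoly_ring S n)"
    then have q: "\<forall>m. q m \<in> carrier S" "finite {m. q m \<noteq> \<zero>\<^bsub>S\<^esub>}" "\<forall>m. q m \<noteq> \<zero>\<^bsub>S\<^esub> \<longrightarrow> set_mset m \<subseteq> {1..n}"
      by (simp_all add: S.mpoly_ring_simps S.indexed_pset_iff)
    \<comment> \<open>Zero coefficients are lifted to zero explicitly: \<open>inv_into\<close> could
      choose a nonzero kernel element there and destroy the finite support.\<close>
    define p where "p m = (if q m = \<zero>\<^bsub>S\<^esub> then \<zero>\<^bsub>R\<^esub> else inv_into (carrier R) h (q m))" for m
    have supp: "{m. p m \<noteq> \<zero>\<^bsub>R\<^esub>} \<subseteq> {m. q m \<noteq> \<zero>\<^bsub>S\<^esub>}" by (auto simp: p_def)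
    then have "finite {m. p m \<noteq> \<zero>\<^bsub>R\<^esub>}" using q(2) by (rule finite_subset)
    moreover have "p m \<in> carrier R" for m
      using q(1) surj by (auto simp: p_def intro!: inv_into_into)
    ultimately have "p \<in> carrier (mpoly_ring R n)"
      using q(3) supp by (auto simp: R.mpoly_ring_simps R.indexed_pset_iff)
    moreover have "h (p m) = q m" for m
      using q(1) surj by (auto simp: p_def f_inv_into_f)
    then have "q = h \<circ> p" by (simp add: fun_eq_iff)
    ultimately show "q \<in> (\<circ>) h ` carrier (mpoly_ring R n)" by blast
  qed
qed

text \<open>The squarefree monomials have only the coefficients 0 and 1, which \<open>h\<close>
  preserves.\<close>

lemma comp_elem_sym: "h \<circ> elem_sym R n i = elem_sym S n i"
proof -
  interpret H: ring_hom_ring "mpoly_ring R n" "mpoly_ring S n" "(\<circ>) h"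
    by (rule comp_ring_hom_ring_mpoly_ring)
  let ?A = "{S. S \<subseteq> {1..n} \<and> card S = i}"
  let ?X = "\<lambda>S m. if m = mset_set S then \<one>\<^bsub>R\<^esub> else \<zero>\<^bsub>R\<^esub>"
  let ?Y = "\<lambda>A m. if m = mset_set A then \<one>\<^bsub>S\<^esub> else \<zero>\<^bsub>S\<^esub>"
  have X: "?X \<in> ?A \<rightarrow> carrier (mpoly_ring R n)"
    by (auto simp: R.mpoly_ring_simps finite_subset[OF _ finite_atLeastAtMost]
        simp del: One_nat_def atLeastAtMost_iff intro!: R.monomial_in_indexed_pset)
  have XY: "(\<circ>) h \<circ> ?X = ?Y" by (simp add: fun_eq_iff)
  show ?thesis unfolding elem_sym_def H.hom_finsum[OF X] XY ..
qed

text \<open>With \<open>h\<close> the projection onto \<open>R Quot L\<close>, the function on the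
  left is \<open>quot_poly R L p\<close>, so this computes the coefficients of \<pi>(f). The sign
  survives because \<open>h\<close> preserves powers of -1.\<close>

lemma signed_coeff_hom:
  assumes "p \<in> carrier (UP R)"
  shows "signed_coeff S n (\<lambda>k. h (up_ring.coeff (UP R) p k)) i = h (signed_coeff R n p i)"
proof -
  interpret UP: UP_ring R "UP R" by unfold_locales
  have p: "p \<in> up R" using assms unfolding UP_def by simp
  \<comment> \<open>\<open>coeff\<close> returns the coefficients only for arguments in
    \<open>up S\<close>, so membership has to be settled before it can be evaluated.\<close>
  have "(\<lambda>k. h (p k)) \<in> up S"
  proof (rule mem_upI)
    show "h (p k) \<in> carrier S" for k using mem_upD[OF p] by simp
    obtain m where "bound \<zero>\<^bsub>R\<^esub> m p" using p by (auto simp: up_def)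
    then have "bound \<zero>\<^bsub>S\<^esub> m (\<lambda>k. h (p k))" by (simp add: bound_def)
    then show "\<exists>m. bound \<zero>\<^bsub>S\<^esub> m (\<lambda>k. h (p k))" ..
  qed
  then have "up_ring.coeff (UP S) (\<lambda>k. h (up_ring.coeff (UP R) p k)) (n - i) =
      h (up_ring.coeff (UP R) p (n - i))"
    by (simp only: coeff_UP[OF p] coeff_UP)
  then show ?thesis
    using UP.coeff_closed[OF assms, of "n - i"] by (simp add: signed_coeff_def hom_nat_pow)
qed

text \<open>The generators correspond one by one: \<open>h\<close> fixes the elementary symmetric
  polynomials and carries each constant to the constant over \<open>S\<close>. Then
  \<open>image_genideal\<close> applies.\<close>

lemma image_splitting_ideal:
  assumes surj: "h ` carrier R = carrier S" and p: "p \<in> carrier (UP R)"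
  shows "(\<circ>) h ` splitting_ideal R n p =
    splitting_ideal S n (\<lambda>k. h (up_ring.coeff (UP R) p k))"
proof -
  interpret UP: UP_ring R "UP R" by unfold_locales
  interpret H: ring_hom_ring "mpoly_ring R n" "mpoly_ring S n" "(\<circ>) h"
    by (rule comp_ring_hom_ring_mpoly_ring)
  let ?gen = "\<lambda>i. elem_sym R n i \<ominus>\<^bsub>mpoly_ring R n\<^esub> R.indexed_const (signed_coeff R n p i)"
  have c: "R.indexed_const (signed_coeff R n p i) \<in> carrier (mpoly_ring R n)" for i
    using UP.coeff_closed[OF p] ring_hom_closed[OF R.indexed_const_ring_hom]
    by (simp add: signed_coeff_def)
  then have G: "?gen ` {1..n} \<subseteq> carrier (mpoly_ring R n)"
    by (auto simp: R.elem_sym_closed)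
  have "h \<circ> ?gen i = elem_sym S n i \<ominus>\<^bsub>mpoly_ring S n\<^esub>
      S.indexed_const (signed_coeff S n (\<lambda>k. h (up_ring.coeff (UP R) p k)) i)" for i
    using c R.elem_sym_closed[of n i]
    by (simp add: a_minus_def comp_elem_sym comp_indexed_const signed_coeff_hom[OF p])
  then show ?thesis
    unfolding splitting_ideal_def H.image_genideal[OF comp_mpoly_ring_surj[OF surj] G] image_image
    by simp
qed

end

context ring
begin

text \<open>A polynomial is the finite sum of its terms, and each term is a coefficient, as a
  constant in \<open>I\<close>, times a monic monomial.\<close>

lemma mem_mpoly_ideal_of_coeffs:
  assumes "ideal I (mpoly_ring R n)" and p: "p \<in> carrier (mpoly_ring R n)"
    and coeffs: "\<And>m. indexed_const (p m) \<in> I"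
  shows "p \<in> I"
proof -
  let ?P = "mpoly_ring R n"
  interpret I: ideal I ?P by fact
  have p': "\<And>m. p m \<in> carrier R" "finite {m. p m \<noteq> \<zero>}" "\<And>m. p m \<noteq> \<zero> \<Longrightarrow> set_mset m \<subseteq> {1..n}"
    using p by (auto simp: mpoly_ring_simps indexed_pset_iff)
  have mon: "(\<lambda>m. if m = M then p M else \<zero>) \<in> I" if M: "p M \<noteq> \<zero>" for M
  proof -
    let ?X = "\<lambda>m. if m = M then \<one> else \<zero>"
    have "?X \<in> carrier ?P"
      using p'(3)[OF M] by (simp add: mpoly_ring_simps monomial_in_indexed_pset)
    then have "indexed_const (p M) \<otimes>\<^bsub>?P\<^esub> ?X \<in> I" using coeffs by (rule I.I_r_closed[rotated])
    moreover have "pconv (indexed_const (p M)) ?X = (\<lambda>m. if m = M then p M else \<zero>)"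
      using pconv_const_left[of "p M" ?X] p'(1) by (auto simp: fun_eq_iff)
    ultimately show ?thesis by (simp add: mpoly_ring_simps)
  qed
  \<comment> \<open>The terms are added one at a time: \<open>F\<close> collects the monomials used
    so far, and taking the whole support for \<open>F\<close> recovers \<open>p\<close>.\<close>
  have "(\<lambda>m. if m \<in> F then p m else \<zero>) \<in> I" if "finite F" "F \<subseteq> {m. p m \<noteq> \<zero>}" for F
    using that
  proof induction
    case empty
    then show ?case using additive_subgroup.zero_closed[OF I.additive_subgroup_axioms]
      by (simp add: mpoly_ring_simps(4) indexed_zero_def)
  next
    case (insert M F)
    have "(\<lambda>m. if m \<in> insert M F then p m else \<zero>) =
        (\<lambda>m. if m = M then p M else \<zero>) \<oplus>\<^bsub>?P\<^esub> (\<lambda>m. if m \<in> F then p m else \<zero>)"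
      using insert p'(1) by (auto simp: fun_eq_iff mpoly_ring_simps indexed_padd_def)
    with insert mon show ?case by (auto intro!: I.a_closed)
  qed
  from this[OF p'(2) order_refl] have "(\<lambda>m. if p m \<noteq> \<zero> then p m else \<zero>) \<in> I" by simp
  also have "(\<lambda>m. if p m \<noteq> \<zero> then p m else \<zero>) = p" by auto
  finally show ?thesis .
qed

end

section \<open>The isomorphism of splitting rings and its linearity over \<open>T\<close>\<close>

theorem lemma3p1:
  fixes R :: "('a, 'm) ring_scheme" and n :: nat and a :: "nat \<Rightarrow> 'a"
  assumes "ring R" and "\<one>\<^bsub>R\<^esub> \<noteq> \<zero>\<^bsub>R\<^esub>" and "n \<ge> 1"
    and "\<And>i. i \<in> {1..n} \<Longrightarrow> a i \<in> carrier R"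
  defines "f \<equiv> monic_poly R n a"
    and "L \<equiv> comm_ideal R n a"
  defines "T \<equiv> R Quot L"
  defines "Rf \<equiv> induced_module (univ_splitting_ring R n f)"
    and "Tf \<equiv> univ_splitting_ring T n (quot_poly R L f)"
  shows "\<exists>\<phi>\<in>ring_iso Rf Tf. \<forall>t\<in>carrier T. \<forall>x\<in>carrier Rf. \<phi> (t \<odot>\<^bsub>Rf\<^esub> x) = t \<odot>\<^bsub>Tf\<^esub> \<phi> x"
proof -
  interpret R: ring R by fact
  note a = assms(4)
  interpret L: ideal L R unfolding L_def by (rule R.comm_ideal_ideal) (fact a)
  interpret h: ring_hom_ring R T "(+>\<^bsub>R\<^esub>) L" unfolding T_def by (rule L.rcos_ring_hom_ring)
  let ?h = "(+>\<^bsub>R\<^esub>) L"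
  let ?P = "mpoly_ring R n" and ?P' = "mpoly_ring T n"
  let ?I = "splitting_ideal R n f" and ?I' = "splitting_ideal T n (quot_poly R L f)"
  interpret H: ring_hom_ring ?P ?P' "(\<circ>) ?h" by (rule h.comp_ring_hom_ring_mpoly_ring)
  have f: "f \<in> carrier (UP R)" unfolding f_def by (rule R.coeff_monic_poly(1)) (fact a)
  have surj: "?h ` carrier R = carrier T" unfolding T_def carrier_FactRing ..
  have sc: "signed_coeff R n f i \<in> carrier R" if "i \<in> {1..n}" for i
    unfolding f_def using R.signed_coeff_monic_poly[of n a, OF a that] a[OF that] by simp
  have sc': "signed_coeff T n (quot_poly R L f) i \<in> carrier T" if "i \<in> {1..n}" for i
    unfolding quot_poly_def h.signed_coeff_hom[OF f] by (rule h.hom_closed[OF sc[OF that]])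
  have I: "ideal ?I ?P" by (rule R.splitting_ideal_ideal) (fact sc)
  have image_I: "(\<circ>) ?h ` ?I = ?I'"
    unfolding quot_poly_def by (rule h.image_splitting_ideal[OF surj f])
  have ker: "a_kernel ?P ?P' ((\<circ>) ?h) \<subseteq> ?I"
  proof
    fix p assume "p \<in> a_kernel ?P ?P' ((\<circ>) ?h)"
    then have p: "p \<in> carrier ?P" and p0: "?h \<circ> p = \<zero>\<^bsub>?P'\<^esub>"
      unfolding a_kernel_def' by blast+
    have "?h (p m) = \<zero>\<^bsub>T\<^esub>" for m
      using fun_cong[OF p0, of m] by (simp add: h.S.mpoly_ring_simps(4) h.S.indexed_zero_def)
    \<comment> \<open>The zero of \<open>R Quot L\<close> is the set \<open>L\<close> itself; as
      \<open>p m\<close> lies in its own coset, it lies in \<open>L\<close>.\<close>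
    then have "?h (p m) = L" for m unfolding T_def FactRing_def ring.simps .
    moreover have "p m \<in> carrier R" for m
      using p by (simp add: R.mpoly_ring_simps R.indexed_pset_iff)
    ultimately have "p m \<in> L" for m using L.a_rcos_self[of "p m"] by metis
    then have "R.indexed_const (p m) \<in> ?I" for m
      unfolding f_def L_def using R.comm_ideal_subset_splitting_ideal[of n a, OF a] by blast
    with I p show "p \<in> ?I" by (rule R.mem_mpoly_ideal_of_coeffs)
  qed
  obtain \<phi> where iso: "\<phi> \<in> ring_iso (?P Quot ?I) (?P' Quot ?I')"
    and \<phi>: "\<And>p. p \<in> carrier ?P \<Longrightarrow> \<phi> (?I +>\<^bsub>?P\<^esub> p) = ?I' +>\<^bsub>?P'\<^esub> (?h \<circ> p)"
    using H.ideal_quotient_iso[OF h.comp_mpoly_ring_surj[OF surj] I ker] unfolding image_I by blast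
  \<comment> \<open>\<open>Rf\<close> and \<open>Tf\<close> have the same ring operations as the two
    quotients and add only a scalar multiplication, so the ring isomorphism carries over
    unchanged.\<close>
  have "\<phi> \<in> ring_iso Rf Tf"
    using iso by (simp add: Rf_def Tf_def induced_module_def univ_splitting_ring_def Let_def
        ring_iso_def ring_hom_def)
  moreover have "\<phi> (t \<odot>\<^bsub>Rf\<^esub> x) = t \<odot>\<^bsub>Tf\<^esub> \<phi> x" if "t \<in> carrier T" and x: "x \<in> carrier Rf" for t x
  proof -
    \<comment> \<open>Linearity is reduced to representatives: \<open>t\<close> acts on
      \<open>Rf\<close> as any \<open>r\<close> in it, and \<open>r\<close> acts as multiplication
      by a constant polynomial.\<close>
    obtain r where r: "r \<in> carrier R" "t = L +>\<^bsub>R\<^esub> r" using \<open>t \<in> _\<close> surj by blast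
    have x': "x \<in> carrier (univ_splitting_ring R n f)" using x by (simp add: Rf_def induced_module_def)
    then obtain p where p: "p \<in> carrier ?P" "x = ?I +>\<^bsub>?P\<^esub> p"
      by (auto simp: univ_splitting_ring_def Let_def FactRing_simps)
    have c: "R.indexed_const r \<in> carrier ?P"
      using ring_hom_closed[OF R.indexed_const_ring_hom r(1)] .
    have "t \<odot>\<^bsub>Rf\<^esub> x = r \<odot>\<^bsub>univ_splitting_ring R n f\<^esub> x"
      unfolding r(2) Rf_def L_def f_def
      by (rule R.induced_module_smult) (use a r x' in \<open>auto simp: f_def\<close>)
    also have "\<dots> = ?I +>\<^bsub>?P\<^esub> (R.indexed_const r \<otimes>\<^bsub>?P\<^esub> p)"
      unfolding p(2) by (rule R.univ_splitting_ring_smult[OF sc r(1) p(1)])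
    finally have "\<phi> (t \<odot>\<^bsub>Rf\<^esub> x) = ?I' +>\<^bsub>?P'\<^esub> (?h \<circ> (R.indexed_const r \<otimes>\<^bsub>?P\<^esub> p))"
      using c p(1) by (simp add: \<phi>)
    \<comment> \<open>The projection is multiplicative and sends the constant \<open>r\<close> to
      the constant \<open>t\<close>, which is how \<open>t\<close> acts on
      \<open>Tf\<close>.\<close>
    also have "?h \<circ> (R.indexed_const r \<otimes>\<^bsub>?P\<^esub> p) = h.S.indexed_const t \<otimes>\<^bsub>?P'\<^esub> (?h \<circ> p)"
      using H.hom_mult[OF c p(1)] by (simp add: h.comp_indexed_const r(2))
    also have "?I' +>\<^bsub>?P'\<^esub> (h.S.indexed_const t \<otimes>\<^bsub>?P'\<^esub> (?h \<circ> p)) = t \<odot>\<^bsub>Tf\<^esub> (?I' +>\<^bsub>?P'\<^esub> (?h \<circ> p))"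
      unfolding Tf_def
      by (rule h.S.univ_splitting_ring_smult[OF sc' \<open>t \<in> carrier T\<close> H.hom_closed[OF p(1)], symmetric])
    finally show ?thesis unfolding p(2) \<phi>[OF p(1)] .
  qed
  ultimately show ?thesis by blast
qed

end
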